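(* Let $n\ge1$, let $\alpha_1,\dots,\alpha_n\in(0,1]$, and let $T_1(\alpha_1),\dots,T_n(\alpha_n)$ be independent random variables, where $T_i(\alpha_i)$ has the distribution of $T(\alpha_i)$. Then for every integer $\ell\ge1$, $$\mathcal{Q}_{2\ell}\left(T_1(\alpha_1)+\cdots+T_n(\alpha_n)\right)=\mathbb{P}\left(T_1(\alpha_1)+\cdots+T_n(\alpha_n)\in(-\ell,\ell]\right).$$
   Context: For a real-valued random variable $X$ and $h>0$, the concentration function is $\mathcal{Q}_h(X)=\sup_{x\in\mathbb{R}}\mathbb{P}(X\in(x,x+h])$. For an integer $k\ge1$, $\nu^k$ denotes the uniform distribution on the $k$-term arithmetic progression $\{-k+1,-k+3,\dots,k-1\}$. For $\alpha\in(0,1]$, choose an integer $k\ge 1$ with $\alpha\in[\frac1{k+1},\frac1k]$; then $T(\alpha)$ denotes a random variable with distribution $(1-\tau)\nu^{k+1}+\tau\nu^k$, where $\tau=k(k+1)\alpha-k$ (this is consistent when $\alpha$ is an endpoint of two such intervals; in particular $T(1/k)$ has distribution $\nu^k$). *)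

theory Defs
  imports "HOL-Probability.Probability"
begin

definition concentration :: "'a measure \<Rightarrow> real \<Rightarrow> ('a \<Rightarrow> real) \<Rightarrow> real" where
  "concentration M h X = (SUP x::real. \<P>(\<omega> in M. X \<omega> \<in> {x<..x + h}))"

definition nu :: "nat \<Rightarrow> real pmf" where
  "nu k = pmf_of_set ((\<lambda>j::nat. - real k + 1 + 2 * real j) ` {..<k})"

definition mix_weight :: "nat \<Rightarrow> real \<Rightarrow> real" where
  "mix_weight k \<alpha> = real k * (real k + 1) * \<alpha> - real k"

text \<open>The mixture \<open>(1 - \<tau>) \<nu>\<^sup>k\<^sup>+\<^sup>1 + \<tau> \<nu>\<^sup>k\<close>, sampled by first choosing the component.
  \<open>bernoulli_pmf\<close> truncates its parameter to \<open>[0, 1]\<close>, but \<open>\<tau>\<close> lies there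
  whenever \<open>\<alpha> \<in> [1/(k+1), 1/k]\<close>; see \<open>mix_weight_range\<close>.\<close>

definition T_mix :: "nat \<Rightarrow> real \<Rightarrow> real pmf" where
  "T_mix k \<alpha> = bind_pmf (bernoulli_pmf (mix_weight k \<alpha>)) (\<lambda>b. if b then nu k else nu (k + 1))"

definition admissible :: "real \<Rightarrow> nat \<Rightarrow> bool" where
  "admissible \<alpha> k \<longleftrightarrow> 1 \<le> k \<and> \<alpha> \<in> {1 / (real k + 1)..1 / real k}"

text \<open>The choice of \<open>k\<close> is immaterial, see \<open>T_pmf_eq\<close>; a choice exists for every
  \<open>\<alpha> \<in> (0, 1]\<close>, see \<open>admissible_exists\<close>.\<close>

definition T_pmf :: "real \<Rightarrow> real pmf" where
  "T_pmf \<alpha> = T_mix (SOME k. admissible \<alpha> k) \<alpha>"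

text \<open>The same law on the Borel sets; a \<open>pmf\<close> lives on the discrete sigma-algebra.\<close>

definition T_law :: "real \<Rightarrow> real measure" where
  "T_law \<alpha> = distr (measure_pmf (T_pmf \<alpha>)) borel (\<lambda>x. x)"

lemma mix_weight_range:
  assumes "admissible \<alpha> k"
  shows "mix_weight k \<alpha> \<in> {0..1}"
proof -
  have k: "real k > 0" and a: "1 / (real k + 1) \<le> \<alpha>" "\<alpha> \<le> 1 / real k"
    using assms by (auto simp: admissible_def)
  have "1 \<le> (real k + 1) * \<alpha>" using a(1) k by (simp add: field_simps)
  then have "real k * 1 \<le> real k * ((real k + 1) * \<alpha>)" using k by (intro mult_left_mono) auto
  moreover have "real k * \<alpha> \<le> 1" using a(2) k by (simp add: field_simps)
  then have "(real k + 1) * (real k * \<alpha>) \<le> (real k + 1) * 1" using k by (intro mult_left_mono) auto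
  ultimately show ?thesis by (simp add: mix_weight_def algebra_simps)
qed

lemma admissible_exists:
  assumes "\<alpha> \<in> {0<..1}"
  shows "\<exists>k. admissible \<alpha> k"
proof -
  define k where "k = nat \<lfloor>1 / \<alpha>\<rfloor>"
  have a: "0 < \<alpha>" "1 \<le> 1 / \<alpha>" using assms by auto
  then have k1: "1 \<le> \<lfloor>1 / \<alpha>\<rfloor>" by linarith
  then have k: "real k = of_int \<lfloor>1 / \<alpha>\<rfloor>" unfolding k_def by (intro of_nat_nat) linarith
  have "real k \<le> 1 / \<alpha>" "1 / \<alpha> \<le> real k + 1" unfolding k by linarith+
  moreover have "1 \<le> k" using k1 unfolding k_def by linarith
  ultimately have "admissible \<alpha> k" using a(1) by (simp add: admissible_def field_simps)
  then show ?thesis ..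
qed

lemma T_mix_left_end:
  assumes "\<alpha> = 1 / (real k + 1)" shows "T_mix k \<alpha> = nu (k + 1)"
proof -
  have "mix_weight k \<alpha> = 0" by (simp add: assms mix_weight_def)
  then show ?thesis
    by (simp add: T_mix_def bernoulli_pmf.rep_eq pmf_eq_iff pmf_bind)
qed

lemma T_mix_right_end:
  assumes "1 \<le> k" "\<alpha> = 1 / real k" shows "T_mix k \<alpha> = nu k"
proof -
  have "mix_weight k \<alpha> = 1" using assms(1) by (simp add: assms(2) mix_weight_def)
  then show ?thesis
    by (simp add: T_mix_def bernoulli_pmf.rep_eq pmf_eq_iff pmf_bind)
qed

lemma T_mix_unique:
  assumes "admissible \<alpha> k" "admissible \<alpha> m"
  shows "T_mix k \<alpha> = T_mix m \<alpha>"
proof -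
  have *: "T_mix k \<alpha> = T_mix m \<alpha>" if "admissible \<alpha> k" "admissible \<alpha> m" "k < m" for k m
  proof -
    have "1 / (real k + 1) \<le> 1 / real m" using that by (auto simp: admissible_def)
    then have "real m \<le> real k + 1" using that by (simp add: admissible_def field_simps)
    then have m: "m = k + 1" using \<open>k < m\<close> by linarith
    then have "\<alpha> = 1 / (real k + 1)" using that by (auto simp: admissible_def algebra_simps)
    then show ?thesis using T_mix_left_end[of \<alpha> k] T_mix_right_end[of m \<alpha>] m by (simp add: algebra_simps)
  qed
  show ?thesis using *[of k m] *[of m k] assms by (metis linorder_neqE_nat)
qed

lemma T_pmf_eq:
  assumes "admissible \<alpha> k"
  shows "T_pmf \<alpha> = T_mix k \<alpha>"
  unfolding T_pmf_def by (rule T_mix_unique) (use assms in \<open>auto intro: someI\<close>)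

end

theory Submission
  imports Defs
begin

text \<open>Say that a law on the integers is unimodal along each parity class if its point masses are
  symmetric and decrease in \<open>\<bar>j\<bar>\<close> among the \<open>j\<close> of one parity. Mixtures preserve this property, and
  so does convolution with \<open>\<nu>\<^sup>k\<close>, because the masses of the convolution at \<open>j\<close> and \<open>j + 2\<close> differ by
  a single telescoping term. Hence the sum of the \<open>T\<^sub>i(\<alpha>\<^sub>i)\<close> has it. A window of \<open>2 l\<close> consecutive
  integers contains \<open>l\<close> integers of each parity, and in \<open>(-l, l]\<close> these are, for both parities at
  once, \<open>l\<close> integers closest to the origin.\<close>

section \<open>Parity-unimodal functions on the integers\<close>

definition parity_unimodal :: "(int \<Rightarrow> real) \<Rightarrow> bool" where
  "parity_unimodal p \<longleftrightarrow> (\<forall>i j. even (i - j) \<longrightarrow> \<bar>i\<bar> \<le> \<bar>j\<bar> \<longrightarrow> p j \<le> p i)"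

lemma parity_unimodalD:
  "parity_unimodal p \<Longrightarrow> even (i - j) \<Longrightarrow> \<bar>i\<bar> \<le> \<bar>j\<bar> \<Longrightarrow> p j \<le> p i"
  by (auto simp: parity_unimodal_def)

text \<open>Symmetry makes \<open>p\<close> a function of the absolute value, and two nonnegative
  integers of one parity are joined by steps of size 2.\<close>

lemma parity_unimodalI:
  assumes sym: "\<And>j. p (- j) = p j"
    and step: "\<And>j. j \<ge> 0 \<Longrightarrow> p (j + 2) \<le> p j"
  shows "parity_unimodal p"
  unfolding parity_unimodal_def
proof (intro allI impI)
  fix i j :: int assume "even (i - j)" "\<bar>i\<bar> \<le> \<bar>j\<bar>"
  then have "even (\<bar>j\<bar> - \<bar>i\<bar>)" "\<bar>j\<bar> - \<bar>i\<bar> \<ge> 0" by auto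
  then obtain m :: nat where m: "\<bar>j\<bar> = \<bar>i\<bar> + 2 * int m"
    by (metis add_diff_cancel_left' diff_add_cancel dvdE nonneg_int_cases zero_le_mult_iff
        add.commute not_numeral_le_zero)
  have *: "p (\<bar>i\<bar> + 2 * int m) \<le> p \<bar>i\<bar>" for m :: nat
  proof (induction m)
    case (Suc m)
    have "p (\<bar>i\<bar> + 2 * int m + 2) \<le> p (\<bar>i\<bar> + 2 * int m)" by (rule step) simp
    with Suc show ?case by (simp add: algebra_simps)
  qed simp
  have abs: "p \<bar>i\<bar> = p i" for i using sym[of i] by (simp add: abs_if)
  show "p j \<le> p i" using *[of m] m abs[of i] abs[of j] by simp
qed

text \<open>Up to the factor 1/k this is the mass function after convolution with
  \<open>nu k\<close>: the argument is \<open>j\<close> minus the support point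
  \<open>- k + 1 + 2 * m\<close>.\<close>

lemma parity_unimodal_progression_sum:
  assumes p: "parity_unimodal p"
  shows "parity_unimodal (\<lambda>j. \<Sum>m<k. p (j + int k - 1 - 2 * int m))"
proof (rule parity_unimodalI)
  \<comment> \<open>Symmetry is built into the definition: \<open>i\<close> and \<open>- i\<close>
    have equal absolute value and differ by an even number, so the inequality holds both
    ways.\<close>
  have sym: "p (- i) = p i" for i
    using parity_unimodalD[OF p, of i "- i"] parity_unimodalD[OF p, of "- i" i] by simp
  fix j :: int
  \<comment> \<open>Reversing the order of summation turns each argument into the negative of an
    argument in the sum at \<open>j\<close>.\<close>
  have "(\<Sum>m<k. p (- j + int k - 1 - 2 * int m))
      = (\<Sum>m<k. p (- j + int k - 1 - 2 * int (k - Suc m)))"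
    by (rule sum.nat_diff_reindex[symmetric])
  also have "\<dots> = (\<Sum>m<k. p (- (j + int k - 1 - 2 * int m)))"
    by (intro sum.cong refl arg_cong[where f = p]) (auto simp: of_nat_diff)
  finally show "(\<Sum>m<k. p (- j + int k - 1 - 2 * int m)) = (\<Sum>m<k. p (j + int k - 1 - 2 * int m))"
    by (simp only: sym)
next
  fix j :: int assume j: "j \<ge> 0"
  \<comment> \<open>With this indexing the sum at \<open>j + 2\<close> runs over
    \<open>f 0, ..., f (k - 1)\<close> and the sum at \<open>j\<close> over
    \<open>f 1, ..., f k\<close>, so only \<open>f 0\<close> and \<open>f k\<close> have to be
    compared. They sit at \<open>j + k + 1\<close> and \<open>j - k + 1\<close>, and for
    \<open>j \<ge> 0\<close> the latter is no farther from the origin.\<close>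
  define f where "f m = p (j + int k + 1 - 2 * int m)" for m
  have "f 0 \<le> f k"
    unfolding f_def by (rule parity_unimodalD[OF p]) (use j in auto)
  moreover have "f 0 + (\<Sum>m<k. f (Suc m)) = (\<Sum>m<k. f m) + f k"
    by (metis sum.lessThan_Suc sum.lessThan_Suc_shift)
  ultimately have "(\<Sum>m<k. f m) \<le> (\<Sum>m<k. f (Suc m))" by simp
  then show "(\<Sum>m<k. p (j + 2 + int k - 1 - 2 * int m)) \<le> (\<Sum>m<k. p (j + int k - 1 - 2 * int m))"
    by (simp add: f_def algebra_simps)
qed

text \<open>Moving the window one step to the right trades \<open>a + 1\<close> for
  \<open>a + 2 * int l + 1\<close>. These have the same parity, so whichever is closer to the origin
  carries at least as much mass.\<close>

lemma parity_unimodal_window_le: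
  assumes p: "parity_unimodal p"
  shows "sum p {a + 1..a + 2 * int l} \<le> sum p {- int l + 1..int l}"
proof -
  define W where "W a = sum p {a + 1..a + 2 * int l}" for a
  have shift: "W (a + 1) + p (a + 1) = W a + p (a + 2 * int l + 1)" for a
  proof -
    have "{a + 1..a + 2 * int l + 1} = insert (a + 1) {a + 1 + 1..a + 1 + 2 * int l}"
      "{a + 1..a + 2 * int l + 1} = insert (a + 2 * int l + 1) {a + 1..a + 2 * int l}" by auto
    then have "sum p (insert (a + 1) {a + 1 + 1..a + 1 + 2 * int l})
        = sum p (insert (a + 2 * int l + 1) {a + 1..a + 2 * int l})" by simp
    then show ?thesis by (simp add: W_def)
  qed
  \<comment> \<open>The two traded points have midpoint \<open>a + int l + 1\<close>, which is
    positive here and at most 0 in \<open>left\<close>; hence the threshold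
    \<open>- int l\<close>.\<close>
  have right: "W (a + 1) \<le> W a" if "a \<ge> - int l" for a
  proof -
    have "p (a + 2 * int l + 1) \<le> p (a + 1)" using that by (intro parity_unimodalD[OF p]) auto
    then show ?thesis using shift[of a] by linarith
  qed
  have left: "W a \<le> W (a + 1)" if "a < - int l" for a
  proof -
    have "p (a + 1) \<le> p (a + 2 * int l + 1)" using that by (intro parity_unimodalD[OF p]) auto
    then show ?thesis using shift[of a] by linarith
  qed
  \<comment> \<open>Two-sided induction, moving away from the central window in either
    direction.\<close>
  have "W a \<le> W (- int l)"
  proof (induction a rule: int_induct[where k = "- int l"])
    case (step1 i)
    then show ?case using right[of i] by simp
  next
    case (step2 i)
    then show ?case using left[of "i - 1"] by simp
  qed simp
  then show ?thesis by (simp add: W_def)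
qed

section \<open>Unimodal laws, mixtures and convolution\<close>

text \<open>The support condition ensures that the masses at integers determine the whole law on the
  reals.\<close>

definition unimodal_pmf :: "real pmf \<Rightarrow> bool" where
  "unimodal_pmf P \<longleftrightarrow> set_pmf P \<subseteq> \<int> \<and> parity_unimodal (\<lambda>j. pmf P (of_int j))"

text \<open>The law of an independent sum. Drawing from \<open>Q\<close> first lets a mixture or a
  finite uniform law in \<open>Q\<close> be pulled to the outside.\<close>

definition conv_pmf :: "real pmf \<Rightarrow> real pmf \<Rightarrow> real pmf" where
  "conv_pmf P Q = bind_pmf Q (\<lambda>t. map_pmf (\<lambda>s. s + t) P)"

text \<open>Point masses of a mixture are averages of those of its components, and each defining
  inequality survives averaging.\<close>

lemma unimodal_pmf_bind:
  assumes "\<And>x. x \<in> set_pmf N \<Longrightarrow> unimodal_pmf (f x)"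
  shows "unimodal_pmf (bind_pmf N f)"
proof -
  have int: "integrable (measure_pmf N) (\<lambda>x. pmf (f x) y)" for y
    by (rule measure_pmf.integrable_const_bound[where B = 1]) (auto simp: pmf_le_1)
  have "pmf (bind_pmf N f) (of_int j) \<le> pmf (bind_pmf N f) (of_int i)"
    if "even (i - j)" "\<bar>i\<bar> \<le> \<bar>j\<bar>" for i j :: int
    unfolding pmf_bind
    by (intro integral_mono_AE int)
      (use assms that in \<open>auto simp: AE_measure_pmf_iff unimodal_pmf_def parity_unimodal_def\<close>)
  then show ?thesis
    using assms by (auto simp: unimodal_pmf_def parity_unimodal_def)
qed

lemma unimodal_pmf_conv_nu:
  assumes P: "unimodal_pmf P" and k: "k \<ge> 1"
  shows "unimodal_pmf (conv_pmf P (nu k))"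
proof -
  let ?g = "\<lambda>j::nat. - real k + 1 + 2 * real j"
  have inj: "inj_on ?g {..<k}" by (auto simp: inj_on_def)
  \<comment> \<open>Here \<open>k \<ge> 1\<close> enters: \<open>pmf_of_set\<close> is the uniform
    law only on a nonempty finite set.\<close>
  have ne: "?g ` {..<k} \<noteq> {}" using k by (auto simp: lessThan_empty_iff)
  have trans: "pmf (map_pmf (\<lambda>s. s + t) P) a = pmf P (a - t)" for a t :: real
    using pmf_map_inj'[of "\<lambda>s. s + t" P "a - t"] by (simp add: inj_def)
  have val: "pmf (conv_pmf P (nu k)) (of_int j)
      = (\<Sum>m<k. pmf P (of_int (j + int k - 1 - 2 * int m))) / real k" for j :: int
  proof -
    have "pmf (conv_pmf P (nu k)) (of_int j)
        = (\<Sum>t\<in>?g ` {..<k}. pmf P (of_int j - t)) / real (card (?g ` {..<k}))"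
      unfolding conv_pmf_def nu_def by (subst pmf_bind_pmf_of_set[OF ne]) (simp_all add: trans)
    also have "\<dots> = (\<Sum>m<k. pmf P (of_int j - ?g m)) / real k"
      by (simp only: sum.reindex[OF inj] card_image[OF inj] card_lessThan o_def)
    also have "(\<Sum>m<k. pmf P (of_int j - ?g m))
        = (\<Sum>m<k. pmf P (of_int (j + int k - 1 - 2 * int m)))"
      by (intro sum.cong refl arg_cong[where f = "pmf P"]) simp
    finally show ?thesis .
  qed
  have "parity_unimodal (\<lambda>j. pmf (conv_pmf P (nu k)) (of_int j))"
    using parity_unimodal_progression_sum[of "\<lambda>j. pmf P (of_int j)" k] P
    unfolding val by (auto simp: unimodal_pmf_def parity_unimodal_def intro!: divide_right_mono)
  moreover have "set_pmf (conv_pmf P (nu k)) \<subseteq> \<int>"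
  proof -
    have "set_pmf (nu k) = ?g ` {..<k}" unfolding nu_def by (rule set_pmf_of_set[OF ne]) simp
    then have "set_pmf (nu k) \<subseteq> \<int>" by auto
    then show ?thesis using P by (auto simp: conv_pmf_def unimodal_pmf_def intro!: Ints_add)
  qed
  ultimately show ?thesis by (simp add: unimodal_pmf_def)
qed

lemma unimodal_pmf_conv_T_pmf:
  assumes P: "unimodal_pmf P" and \<alpha>: "\<alpha> \<in> {0<..1}"
  shows "unimodal_pmf (conv_pmf P (T_pmf \<alpha>))"
proof -
  obtain k where k: "admissible \<alpha> k" using admissible_exists[OF \<alpha>] by blast
  then have "k \<ge> 1" by (simp add: admissible_def)
  \<comment> \<open>Associativity of bind moves the Bernoulli choice outermost, leaving a mixture of
    two convolutions with progressions.\<close>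
  have "conv_pmf P (T_pmf \<alpha>) = bind_pmf (bernoulli_pmf (mix_weight k \<alpha>))
      (\<lambda>b. if b then conv_pmf P (nu k) else conv_pmf P (nu (k + 1)))"
    unfolding T_pmf_eq[OF k] T_mix_def conv_pmf_def bind_assoc_pmf
    by (intro bind_pmf_cong refl) auto
  then show ?thesis
    using \<open>k \<ge> 1\<close> by (auto intro!: unimodal_pmf_bind unimodal_pmf_conv_nu P)
qed

section \<open>The law of the independent sum\<close>

text \<open>Links convolution of Borel measures to \<open>conv_pmf\<close>. The left factor of
  \<open>\<star>\<close> is the outer integral, which matches drawing from \<open>Q\<close>
  first.\<close>

lemma convolution_distr_pmf:
  fixes P Q :: "real pmf"
  shows "distr (measure_pmf Q) borel (\<lambda>x. x) \<star> distr (measure_pmf P) borel (\<lambda>x. x)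
    = distr (measure_pmf (conv_pmf P Q)) borel (\<lambda>x. x)"
proof (rule measure_eqI)
  have fin: "finite_measure (distr (measure_pmf R) borel (\<lambda>x. x))" for R :: "real pmf"
    by (intro measure_pmf.finite_measure_distr) simp
  fix A assume "A \<in> sets (distr (measure_pmf Q) borel (\<lambda>x. x) \<star> distr (measure_pmf P) borel (\<lambda>x. x))"
  then have A[measurable]: "A \<in> sets borel" by simp
  have "emeasure (distr (measure_pmf Q) borel (\<lambda>x. x) \<star> distr (measure_pmf P) borel (\<lambda>x. x)) A
      = (\<integral>\<^sup>+x. \<integral>\<^sup>+y. indicator A (x + y) \<partial>distr (measure_pmf P) borel (\<lambda>x. x)
          \<partial>distr (measure_pmf Q) borel (\<lambda>x. x))"
    by (rule convolution_emeasure') (auto simp: fin)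
  also have "\<dots> = (\<integral>\<^sup>+x. \<integral>\<^sup>+y. indicator A (x + y) \<partial>distr (measure_pmf P) borel (\<lambda>x. x) \<partial>measure_pmf Q)"
  proof -
    \<comment> \<open>Finiteness of the inner law makes the inner integral measurable in
      \<open>x\<close>.\<close>
    interpret finite_measure "distr (measure_pmf P) borel (\<lambda>x. x)" by (rule fin)
    show ?thesis by (rule nn_integral_distr) measurable
  qed
  also have "\<dots> = (\<integral>\<^sup>+x. emeasure (map_pmf (\<lambda>s. s + x) P) A \<partial>measure_pmf Q)"
  proof (rule nn_integral_cong)
    fix x :: real
    have "(\<integral>\<^sup>+y. indicator A (x + y) \<partial>distr (measure_pmf P) borel (\<lambda>x. x))
        = (\<integral>\<^sup>+y. indicator A (x + y) \<partial>measure_pmf P)"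
      by (rule nn_integral_distr) measurable
    also have "\<dots> = (\<integral>\<^sup>+y. indicator ((\<lambda>s. s + x) -` A) y \<partial>measure_pmf P)"
      by (intro nn_integral_cong) (auto simp: indicator_def add.commute)
    finally show "(\<integral>\<^sup>+y. indicator A (x + y) \<partial>distr (measure_pmf P) borel (\<lambda>x. x))
        = emeasure (map_pmf (\<lambda>s. s + x) P) A" by simp
  qed
  also have "\<dots> = emeasure (distr (measure_pmf (conv_pmf P Q)) borel (\<lambda>x. x)) A"
    by (simp add: emeasure_distr conv_pmf_def)
  finally show "emeasure (distr (measure_pmf Q) borel (\<lambda>x. x) \<star> distr (measure_pmf P) borel (\<lambda>x. x)) A
      = emeasure (distr (measure_pmf (conv_pmf P Q)) borel (\<lambda>x. x)) A" .
qed simp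

text \<open>The induction starts from the point mass at 0, the law of the empty sum, and convolves
  with one \<open>T_pmf\<close> at a time. A general finite \<open>I\<close> lets independence pass
  to the smaller family.\<close>

lemma (in prob_space) sum_T_law_unimodal:
  fixes T :: "'i \<Rightarrow> 'a \<Rightarrow> real"
  assumes "finite I" "indep_vars (\<lambda>_. borel) T I"
    and "\<And>i. i \<in> I \<Longrightarrow> \<alpha> i \<in> {0<..1}"
    and "\<And>i. i \<in> I \<Longrightarrow> distr M borel (T i) = T_law (\<alpha> i)"
  shows "\<exists>P. unimodal_pmf P \<and>
    distr M borel (\<lambda>\<omega>. \<Sum>i\<in>I. T i \<omega>) = distr (measure_pmf P) borel (\<lambda>x. x)"
  using assms
proof (induction I rule: finite_induct)
  case empty
  have "unimodal_pmf (return_pmf 0)"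
    by (auto simp: unimodal_pmf_def parity_unimodal_def pmf_return indicator_def)
  moreover have "distr M borel (\<lambda>\<omega>. 0) = distr (measure_pmf (return_pmf 0)) borel (\<lambda>x::real. x)"
    by (intro measure_eqI)
      (auto simp: emeasure_distr emeasure_space_1 split: split_indicator)
  ultimately show ?case by auto
next
  case (insert i I)
  have ind: "indep_vars (\<lambda>_. borel) T I"
    by (rule indep_vars_subset[OF insert.prems(1)]) auto
  from insert.IH[OF ind] insert.prems obtain P where P: "unimodal_pmf P"
    "distr M borel (\<lambda>\<omega>. \<Sum>i\<in>I. T i \<omega>) = distr (measure_pmf P) borel (\<lambda>x. x)" by auto
  have meas: "random_variable borel (T j)" if "j \<in> insert i I" for j
    using insert.prems(1) that unfolding indep_vars_def by auto
  have "distr M borel (\<lambda>\<omega>. \<Sum>j\<in>insert i I. T j \<omega>)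
      = distr M borel (\<lambda>\<omega>. T i \<omega> + (\<Sum>j\<in>I. T j \<omega>))"
    using insert.hyps by simp
  \<comment> \<open>\<open>T i\<close> is independent of the sum over \<open>I\<close>, so the law
    of the total is a convolution.\<close>
  also have "\<dots> = (distr M borel (T i) \<star> distr M borel (\<lambda>\<omega>. \<Sum>j\<in>I. T j \<omega>))"
    using insert.hyps insert.prems(1) meas
    by (intro sum_indep_random_variable indep_vars_sum borel_measurable_sum) auto
  also have "\<dots> = distr (measure_pmf (conv_pmf P (T_pmf (\<alpha> i)))) borel (\<lambda>x. x)"
    using insert.prems(3)[of i] by (simp add: P(2) T_law_def convolution_distr_pmf)
  finally show ?case
    using unimodal_pmf_conv_T_pmf[OF P(1), of "\<alpha> i"] insert.prems(2) by blast
qed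

section \<open>Windows and the concentration function\<close>

text \<open>A half-open interval of length \<open>2 * l\<close> contains exactly
  \<open>2 * l\<close> integers wherever it starts, so real windows reduce to integer windows
  indexed by the floor of \<open>x\<close>.\<close>

lemma prob_window_eq_sum:
  fixes P :: "real pmf"
  assumes "set_pmf P \<subseteq> \<int>"
  shows "measure_pmf.prob P {x<..x + 2 * real l}
    = (\<Sum>j\<in>{\<lfloor>x\<rfloor> + 1..\<lfloor>x\<rfloor> + 2 * int l}. pmf P (of_int j))"
proof -
  let ?J = "{\<lfloor>x\<rfloor> + 1..\<lfloor>x\<rfloor> + 2 * int l}"
  have mem: "real_of_int j \<in> {x<..x + 2 * real l} \<longleftrightarrow> j \<in> ?J" for j
  proof -
    have "x < of_int j \<longleftrightarrow> \<lfloor>x\<rfloor> + 1 \<le> j" by linarith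
    moreover have "of_int j \<le> x + 2 * real l \<longleftrightarrow> j \<le> \<lfloor>x\<rfloor> + 2 * int l" by linarith
    ultimately show ?thesis by simp
  qed
  have "measure_pmf.prob P {x<..x + 2 * real l} = measure_pmf.prob P (of_int ` ?J)"
  \<comment> \<open>The two sets agree on the integers, which carry all the mass of
    \<open>P\<close>.\<close>
  proof (rule measure_pmf.finite_measure_eq_AE)
    show "AE y in measure_pmf P. y \<in> {x<..x + 2 * real l} \<longleftrightarrow> y \<in> of_int ` ?J"
      unfolding AE_measure_pmf_iff
    proof
      fix y assume "y \<in> set_pmf P"
      then obtain j where "y = of_int j" using assms by (auto elim: Ints_cases)
      then show "y \<in> {x<..x + 2 * real l} \<longleftrightarrow> y \<in> of_int ` ?J"
        using mem[of j] by (auto simp del: atLeastAtMost_iff greaterThanAtMost_iff)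
    qed
  qed auto
  also have "\<dots> = (\<Sum>j\<in>?J. pmf P (of_int j))"
    by (subst measure_measure_pmf_finite) (auto simp: sum.reindex inj_on_def)
  finally show ?thesis .
qed

theorem mainTheorem2:
  fixes M :: "'a measure" and n l :: nat
    and \<alpha> :: "nat \<Rightarrow> real" and T :: "nat \<Rightarrow> 'a \<Rightarrow> real"
  assumes "prob_space M"
    and "n \<ge> 1"
    and "\<And>i. i \<in> {1..n} \<Longrightarrow> \<alpha> i \<in> {0<..1}"
    and "prob_space.indep_vars M (\<lambda>_. borel) T {1..n}"
    and "\<And>i. i \<in> {1..n} \<Longrightarrow> distr M borel (T i) = T_law (\<alpha> i)"
    and "l \<ge> 1"
  shows "concentration M (2 * real l) (\<lambda>\<omega>. \<Sum>i=1..n. T i \<omega>)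
    = \<P>(\<omega> in M. (\<Sum>i=1..n. T i \<omega>) \<in> {- real l<..real l})"
proof -
  interpret prob_space M by fact
  let ?S = "\<lambda>\<omega>. \<Sum>i=1..n. T i \<omega>"
  obtain P where P: "unimodal_pmf P"
    and law: "distr M borel ?S = distr (measure_pmf P) borel (\<lambda>x. x)"
    using sum_T_law_unimodal[of "{1..n}" T \<alpha>] assms by auto
  have S[measurable]: "?S \<in> borel_measurable M"
    using assms(4) by (intro borel_measurable_sum) (auto simp: indep_vars_def)
  have prob_eq: "\<P>(\<omega> in M. ?S \<omega> \<in> {x<..x + 2 * real l})
      = (\<Sum>j\<in>{\<lfloor>x\<rfloor> + 1..\<lfloor>x\<rfloor> + 2 * int l}. pmf P (of_int j))" for x
  proof -
    have "\<P>(\<omega> in M. ?S \<omega> \<in> {x<..x + 2 * real l})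
        = measure (distr M borel ?S) {x<..x + 2 * real l}"
      by (subst measure_distr[OF S]) (auto intro!: arg_cong[where f = prob])
    also have "\<dots> = measure_pmf.prob P {x<..x + 2 * real l}"
      unfolding law by (subst measure_distr) auto
    also have "\<dots> = (\<Sum>j\<in>{\<lfloor>x\<rfloor> + 1..\<lfloor>x\<rfloor> + 2 * int l}. pmf P (of_int j))"
      using P by (intro prob_window_eq_sum) (auto simp: unimodal_pmf_def)
    finally show ?thesis .
  qed
  \<comment> \<open>The right endpoint \<open>real l\<close> is written as
    \<open>- real l + 2 * real l\<close> so that \<open>prob_eq\<close> applies to both sides, with
    \<open>x = - real l\<close> on the right.\<close>
  have max: "\<P>(\<omega> in M. ?S \<omega> \<in> {x<..x + 2 * real l})
      \<le> \<P>(\<omega> in M. ?S \<omega> \<in> {- real l<..- real l + 2 * real l})" for x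
  proof -
    have "\<lfloor>- real l\<rfloor> = - int l" by linarith
    then show ?thesis
      using parity_unimodal_window_le[of "\<lambda>j. pmf P (of_int j)" "\<lfloor>x\<rfloor>" l] P
      unfolding prob_eq by (simp add: unimodal_pmf_def)
  qed
  have "concentration M (2 * real l) ?S
      = \<P>(\<omega> in M. ?S \<omega> \<in> {- real l<..- real l + 2 * real l})"
    \<comment> \<open>The supremum is attained at \<open>x = - real l\<close>, so it is a
      maximum.\<close>
    unfolding concentration_def using max by (intro cSup_eq_maximum) blast+
  then show ?thesis by simp
qed

end
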